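(* Let $C>0$ be a constant and define the linear program $$P_{\mathrm{distr}}:\quad \min\{\mathbf c^T\mathbf x \mid \mathbf A\mathbf x=\mathbf b,\ \mathbf 0\le \mathbf x\le C\boldsymbol\xi\}.$$ Let $J=\{j_1,\dots,j_K\}$ be drawn i.i.d. from $\boldsymbol\xi$ and let $P_J$ be the column-randomized LP. Let $\gamma$ be an upper bound on $\|\mathbf p\|_\infty$ for every basic solution $\mathbf p$ of the dual problem $D$. For any $\delta\in(0,1)$, with probability at least $1-\delta$ over the sample $J$, the following implication holds: if $P_J$ is feasible and $\mathrm{rank}(\mathbf A_J)=m$, then $$\Delta v(P_J)\le \Delta v(P_{\mathrm{distr}})+\frac{C\,(1+m\gamma\|\mathbf A\|_{\max})}{\sqrt K}\left(1+\sqrt{2\log\frac{2}{\delta}}\right).$$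
   Context: The complete problem is $P:\ \min\{\mathbf c^T\mathbf x\mid \mathbf A\mathbf x=\mathbf b,\ \mathbf x\ge \mathbf 0\}$ with $\mathbf A\in\mathbb R^{m\times n}$, $\mathbf b\in\mathbb R^m$, $\mathbf c\in\mathbb R^n$. Standing assumptions: $P$ is feasible and bounded, $\mathrm{rank}(\mathbf A)=m$, and $\|\mathbf c\|_2=1$. Its dual is $D:\ \max\{\mathbf p^T\mathbf b\mid \mathbf p^T\mathbf A\le \mathbf c^T\}$. $\mathbf A_j$ denotes the $j$th column of $\mathbf A$ and $\|\mathbf A\|_{\max}=\max_{i,j}|A_{i,j}|$. A basis is a set $B\subseteq[n]=\{1,\dots,n\}$ with $|B|=m$ and $\mathbf A_B$ nonsingular; the corresponding basic solution of $D$ (not necessarily feasible) is $\mathbf p^T=\mathbf c_B^T\mathbf A_B^{-1}$. $\boldsymbol\xi=(\xi_1,\dots,\xi_n)$ is a probability distribution on $[n]$. The indices $j_1,\dots,j_K\in[n]$ are independent with $\Pr[j_k=t]=\xi_t$ (repetitions possible). $\mathbf A_J$ is the matrix with columns $\mathbf A_{j_1},\dots,\mathbf A_{j_K}$, $\mathbf c_J=(c_{j_1},\dots,c_{j_K})$, and $P_J:\ \min\{\mathbf c_J^T\tilde{\mathbf x}\mid \mathbf A_J\tilde{\mathbf x}=\mathbf b,\ \tilde{\mathbf x}\ge\mathbf 0\}$. $v(\cdot)$ denotes the optimal value of a problem, with $v=+\infty$ for an infeasible minimization problem, and $\Delta v(P'')=v(P'')-v(P)$. *)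

theory Defs
  imports "HOL-Probability.Probability"
begin

text \<open>
  Linear programs are in standard form, with the number of rows, the number of columns and the
  sample size given by finite index types. The order on vectors is the componentwise one.
\<close>

definition std_feasible :: "real^'n^'m \<Rightarrow> real^'m \<Rightarrow> (real^'n) set" where
  "std_feasible A b = {x. A *v x = b \<and> 0 \<le> x}"

definition distr_feasible ::
    "real^'n^'m \<Rightarrow> real^'m \<Rightarrow> real \<Rightarrow> real^'n \<Rightarrow> (real^'n) set" where
  "distr_feasible A b C \<xi> = {x. A *v x = b \<and> 0 \<le> x \<and> x \<le> C *\<^sub>R \<xi>}"

text \<open>
  The optimal value of minimizing \<open>c \<bullet> x\<close> over \<open>x \<in> X\<close>. As an infimum of extended reals it
  is \<open>\<infinity>\<close> for an infeasible problem and \<open>-\<infinity>\<close> for an unbounded one.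
\<close>

definition opt_value :: "real^'n \<Rightarrow> (real^'n) set \<Rightarrow> ereal" where
  "opt_value c X = (INF x\<in>X. ereal (c \<bullet> x))"

text \<open>
  Selection of columns (and of the matching costs) along a map \<open>f\<close> of indices. Repetitions are
  allowed. For a sample \<open>J\<close> this is \<open>A\<^sub>J\<close>, and for an enumeration of a set \<open>B\<close> of
  column indices it is \<open>A\<^sub>B\<close>.
\<close>

definition select_cols :: "real^'n^'m \<Rightarrow> ('k \<Rightarrow> 'n) \<Rightarrow> real^'k^'m" where
  "select_cols A f = (\<chi> i k. A $ i $ f k)"

definition select_entries :: "real^'n \<Rightarrow> ('k \<Rightarrow> 'n) \<Rightarrow> real^'k" where
  "select_entries c f = (\<chi> k. c $ f k)"

text \<open>
  To be a square matrix indexed by \<open>'m\<close> on both sides, \<open>A\<^sub>B\<close> needs an enumeration of \<open>B\<close>.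
  Neither nonsingularity nor the basic solution depends on its choice, and one exists as soon as
  \<open>card B = CARD('m)\<close>.
\<close>

definition is_basis :: "real^'n^'m \<Rightarrow> 'n set \<Rightarrow> bool" where
  "is_basis A B \<longleftrightarrow> card B = CARD('m) \<and>
     (\<forall>f :: 'm \<Rightarrow> 'n. bij_betw f UNIV B \<longrightarrow> invertible (select_cols A f))"

text \<open>
  Basic solutions of the dual, maximizing \<open>p \<bullet> b\<close> subject to \<open>p v* A \<le> c\<close>: those of the form
  \<open>c\<^sub>B\<^sup>T A\<^sub>B\<^sup>-\<^sup>1\<close> for a basis \<open>B\<close>. They need not be feasible.
\<close>

definition dual_basic_solution :: "real^'n^'m \<Rightarrow> real^'n \<Rightarrow> real^'m \<Rightarrow> bool" where
  "dual_basic_solution A c p \<longleftrightarrow>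
     (\<exists>B (f :: 'm \<Rightarrow> 'n). is_basis A B \<and> bij_betw f UNIV B \<and>
        p = select_entries c f v* matrix_inv (select_cols A f))"

definition max_norm :: "real^'n^'m \<Rightarrow> real" where
  "max_norm A = Max {\<bar>A $ i $ j\<bar> | i j. True}"

end

theory Submission
  imports Defs
begin

text \<open>
  Let \<open>x\<close> be optimal for \<open>P\<^sub>d\<^sub>i\<^sub>s\<^sub>t\<^sub>r\<close> and give the \<open>k\<close>-th sampled column the weight \<open>x\<^sub>t / (K \<xi>\<^sub>t)\<close>, \<open>t = j\<^sub>k\<close>. The
  resulting \<open>y \<ge> 0\<close> satisfies \<open>A\<^sub>J y = b\<close> and \<open>c\<^sub>J \<bullet> y = c \<bullet> x\<close> only in expectation, and \<open>P\<^sub>J\<close> forgives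
  the infeasibility at a price: a basic dual solution \<open>p\<close> of \<open>P\<^sub>J\<close> is a basic solution of \<open>D\<close>, so
  \<open>v(P\<^sub>J) = p \<bullet> b \<le> c\<^sub>J \<bullet> y + \<gamma> \<parallel>A\<^sub>J y - b\<parallel>\<^sub>1\<close>. The right-hand side is a function of independent samples,
  each of which changes it by at most \<open>2 C (1 + m \<gamma> \<parallel>A\<parallel>\<^sub>m\<^sub>a\<^sub>x) / K\<close>, so McDiarmid's inequality applies
  to it as a whole; its expectation is bounded through the variance of the sample means.
\<close>

subsection \<open>Linear programming duality with basic dual solutions\<close>

text \<open>A strict threshold \<open>u\<close> below all feasible costs replaces the optimal value,
  so no primal optimum has to be exhibited. Closedness of the finitely generated cone provides the
  separation.\<close>

lemma lp_strong_duality: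
  fixes A :: "real^'n^'m" and b :: "real^'m" and c :: "real^'n"
  assumes feas: "x0 \<in> std_feasible A b"
    and above: "\<And>x. x \<in> std_feasible A b \<Longrightarrow> u < c \<bullet> x"
  obtains p where "p v* A \<le> c" "u < p \<bullet> b"
proof -
  \<comment> \<open>Separate \<open>(b, u)\<close> from the closed cone of all pairs (right-hand side, cost no less than attainable).\<close>
  define S where "S = insert (0, 1) (range (\<lambda>j. (column j A, c $ j)))"
  define E where "E = {(A *v x, c \<bullet> x + s) |x s. 0 \<le> x \<and> (0::real) \<le> s}"
  have "convex_cone E"
    unfolding convex_cone_def
  proof (intro conjI ballI allI impI)
    show "E \<noteq> {}" unfolding E_def using order_refl by blast
    show "convex E"
    proof (rule convexI)
      fix y z and v w :: real
      assume "y \<in> E" "z \<in> E" and vw: "0 \<le> v" "0 \<le> w"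
      then obtain x s x' s' where
        "y = (A *v x, c \<bullet> x + s)" "0 \<le> x" "0 \<le> s"
        "z = (A *v x', c \<bullet> x' + s')" "0 \<le> x'" "0 \<le> s'"
        unfolding E_def by blast
      then show "v *\<^sub>R y + w *\<^sub>R z \<in> E"
        unfolding E_def using vw
        by (intro CollectI exI[of _ "v *\<^sub>R x + w *\<^sub>R x'"] exI[of _ "v * s + w * s'"])
           (auto simp: matrix_vector_right_distrib matrix_vector_mult_scaleR inner_add_right
             algebra_simps less_eq_vec_def)
    qed
    show "conic E"
      unfolding conic_def
    proof (intro allI impI)
      fix y and v :: real
      assume "y \<in> E" and v: "0 \<le> v"
      then obtain x s where "y = (A *v x, c \<bullet> x + s)" "0 \<le> x" "0 \<le> s"
        unfolding E_def by blast
      then show "v *\<^sub>R y \<in> E"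
        unfolding E_def using v
        by (intro CollectI exI[of _ "v *\<^sub>R x"] exI[of _ "v * s"])
           (auto simp: matrix_vector_mult_scaleR algebra_simps less_eq_vec_def)
    qed
  qed
  moreover have "S \<subseteq> E"
  proof -
    have "(column j A, c $ j) \<in> E" for j
    proof -
      have "0 \<le> (axis j 1 :: real^'n)" by (simp add: less_eq_vec_def axis_def)
      then show ?thesis
        unfolding E_def
        by (intro CollectI exI[of _ "axis j 1"] exI[of _ 0])
           (simp add: inner_axis matrix_vector_mult_basis)
    qed
    moreover have "(0, 1) \<in> E"
      unfolding E_def by (intro CollectI exI[of _ 0] exI[of _ 1]) auto
    ultimately show ?thesis unfolding S_def by blast
  qed
  ultimately have hull: "convex_cone hull S \<subseteq> E"
    by (rule hull_minimal[rotated])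
  have "(b, u) \<notin> E"
  proof
    assume "(b, u) \<in> E"
    then obtain x s where "b = A *v x" "u = c \<bullet> x + s" "0 \<le> x" "0 \<le> s"
      unfolding E_def by blast
    then show False
      using above[of x] by (auto simp: std_feasible_def)
  qed
  then have notin: "(b, u) \<notin> convex_cone hull S" using hull by blast
  have "finite S" unfolding S_def by simp
  then obtain a \<beta> where
    lt: "a \<bullet> (b, u) < \<beta>" and gt: "\<And>y. y \<in> convex_cone hull S \<Longrightarrow> \<beta> < a \<bullet> y"
    using separating_hyperplane_closed_point[OF convex_convex_cone_hull closed_convex_cone_hull notin]
    by blast
  obtain p q where a: "a = (p, q)" by (cases a)
  have "\<beta> < 0" using gt[OF convex_cone_hull_contains_0] by simp
  \<comment> \<open>A generator with negative inner product could be rescaled until it lies on the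
    separating hyperplane, yet the whole cone is strictly on one side of it.\<close>
  have nonneg: "0 \<le> a \<bullet> y" if "y \<in> S" for y
  proof (rule ccontr)
    assume neg: "\<not> 0 \<le> a \<bullet> y"
    have "(\<beta> / (a \<bullet> y)) *\<^sub>R y \<in> convex_cone hull S"
      using that neg \<open>\<beta> < 0\<close>
      by (intro convex_cone_hull_mul hull_inc) (auto simp: zero_le_divide_iff)
    from gt[OF this] show False using neg by simp
  qed
  have q: "0 \<le> q" using nonneg[of "(0, 1)"] by (simp add: S_def a)
  have col: "0 \<le> (p v* A) $ j + q * c $ j" for j
    using nonneg[of "(column j A, c $ j)"]
    by (simp add: S_def a vector_matrix_mult_def column_def inner_vec_def mult.commute)
  have lt0: "p \<bullet> b + q * u < 0" using lt \<open>\<beta> < 0\<close> by (simp add: a)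
  \<comment> \<open>With \<open>q = 0\<close>, \<open>p\<close> would be a Farkas certificate of
    primal infeasibility, contradicting \<open>x0\<close>.\<close>
  have "q \<noteq> 0"
  proof
    assume "q = 0"
    have "0 \<le> (p v* A) \<bullet> x0"
      using col feas unfolding inner_vec_def
      by (intro sum_nonneg) (auto simp: \<open>q = 0\<close> std_feasible_def less_eq_vec_def)
    then show False
      using lt0 feas by (simp add: \<open>q = 0\<close> std_feasible_def dot_lmul_matrix)
  qed
  with q have "0 < q" by simp
  \<comment> \<open>Dividing by \<open>q\<close> normalizes the cost coefficient to 1; the sign
    turns \<open>p v* A + q c \<ge> 0\<close> into dual feasibility.\<close>
  define p' where "p' = (- 1 / q) *\<^sub>R p"
  have "(p' v* A) $ j \<le> c $ j" for j
  proof -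
    have "(p' v* A) $ j = - ((p v* A) $ j) / q"
      by (simp add: p'_def vector_matrix_mult_def sum_distrib_left sum_divide_distrib flip: sum_negf)
    then have "q * (p' v* A) $ j \<le> q * c $ j" using col[of j] \<open>0 < q\<close> by simp
    then show ?thesis using \<open>0 < q\<close> by simp
  qed
  moreover have "u < p' \<bullet> b" using lt0 \<open>0 < q\<close> by (simp add: p'_def field_simps)
  ultimately show ?thesis by (intro that[of p']) (auto simp: less_eq_vec_def)
qed

lemma weak_duality:
  fixes A :: "real^'n^'m"
  assumes "p v* A \<le> c" "0 \<le> x"
  shows "p \<bullet> (A *v x) \<le> c \<bullet> x"
proof -
  have "(p v* A) \<bullet> x \<le> c \<bullet> x"
    using assms unfolding inner_vec_def by (intro sum_mono) (auto simp: less_eq_vec_def mult_right_mono)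
  then show ?thesis by (simp add: dot_lmul_matrix)
qed

lemma vector_matrix_add_scaleR_component:
  fixes A :: "real^'n^'m"
  shows "((p + t *\<^sub>R d) v* A) $ j = (p v* A) $ j + t * (d v* A) $ j"
  by (simp add: vector_matrix_mult_def sum.distrib sum_distrib_left algebra_simps)

lemma full_row_rank_kernel:
  fixes A :: "real^'n^'m"
  assumes "rank A = CARD('m)" "d v* A = 0"
  shows "d = 0"
proof -
  obtain x where "A *v x = d" using assms(1) by (metis full_rank_surjective surj_def)
  then have "d \<bullet> d = 0" using dot_lmul_matrix[of d A x] assms(2) by simp
  then show ?thesis by simp
qed

text \<open>
  As long as the active constraints do not determine \<open>p\<close>, move along a direction orthogonal to the
  active columns, without decreasing the objective, until another constraint becomes active.
  Feasibility of the primal and full row rank ensure that some such direction is blocked.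
\<close>
lemma dual_purification:
  fixes A :: "real^'n^'m" and b :: "real^'m" and c :: "real^'n"
  assumes feas: "x0 \<in> std_feasible A b" and rank: "rank A = CARD('m)" and "p v* A \<le> c"
  shows "\<exists>p'. p' v* A \<le> c \<and> p \<bullet> b \<le> p' \<bullet> b \<and>
    (\<forall>d. (\<forall>j. (p' v* A) $ j = c $ j \<longrightarrow> (d v* A) $ j = 0) \<longrightarrow> d = 0)"
  using \<open>p v* A \<le> c\<close>
proof (induction "card {j. (p v* A) $ j \<noteq> c $ j}" arbitrary: p rule: less_induct)
  case less
  show ?case
  proof (cases "\<forall>d. (\<forall>j. (p v* A) $ j = c $ j \<longrightarrow> (d v* A) $ j = 0) \<longrightarrow> d = 0")
    case True
    with less.prems show ?thesis by blast
  next
    case False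
    have uminus: "(- d v* A) $ j = - ((d v* A) $ j)" for d j
      using vector_matrix_add_scaleR_component[of 0 "- 1" d A j] by simp
    obtain d0 where d0: "\<And>j. (p v* A) $ j = c $ j \<Longrightarrow> (d0 v* A) $ j = 0" "d0 \<noteq> 0"
      using False by blast
    obtain d where d: "\<And>j. (p v* A) $ j = c $ j \<Longrightarrow> (d v* A) $ j = 0" "d \<noteq> 0" "0 \<le> d \<bullet> b"
    proof (cases "0 \<le> d0 \<bullet> b")
      case True
      with d0 show ?thesis by (intro that[of d0]) auto
    next
      case False
      with d0 show ?thesis by (intro that[of "- d0"]) (auto simp: uminus)
    qed
    \<comment> \<open>If \<open>d v* A\<close> has no positive entry, weak duality with zero cost
      gives \<open>d \<bullet> b \<le> 0\<close>, hence equality, so \<open>- d\<close> does not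
      decrease the objective either. Full row rank gives \<open>d v* A\<close> a nonzero entry, so
      \<open>- d\<close> meets a constraint.\<close>
    obtain e where e: "\<And>j. (p v* A) $ j = c $ j \<Longrightarrow> (e v* A) $ j = 0" "0 \<le> e \<bullet> b"
      "\<exists>j. 0 < (e v* A) $ j"
    proof (cases "\<exists>j. 0 < (d v* A) $ j")
      case True
      with d show ?thesis by (intro that[of d]) auto
    next
      case False
      then have "d v* A \<le> 0" by (auto simp: less_eq_vec_def not_less)
      with weak_duality[OF this, of x0] feas have "d \<bullet> b \<le> 0"
        by (simp add: std_feasible_def)
      have "\<exists>j. (d v* A) $ j \<noteq> 0"
      proof (rule ccontr)
        assume "\<not> ?thesis"
        then have zero: "d v* A = 0" by (simp add: vec_eq_iff)
        with full_row_rank_kernel[OF rank] d show False by blast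
      qed
      then obtain j where "(d v* A) $ j \<noteq> 0" ..
      with False have "(d v* A) $ j < 0" by (metis linorder_neqE_linordered_idom)
      with d \<open>d \<bullet> b \<le> 0\<close> show ?thesis
        by (intro that[of "- d"]) (auto simp: uminus intro: exI[of _ j])
    qed
    \<comment> \<open>Ratio test: \<open>t\<close> is the largest step along \<open>e\<close> that
      preserves dual feasibility, and an index \<open>j0\<close> attaining the minimum becomes
      active.\<close>
    define R where "R = {j. 0 < (e v* A) $ j}"
    define r where "r j = (c $ j - (p v* A) $ j) / (e v* A) $ j" for j
    define t where "t = Min (r ` R)"
    have "t \<in> r ` R" unfolding t_def using e(3) by (intro Min_in) (auto simp: R_def)
    then obtain j0 where j0: "j0 \<in> R" "t = r j0" by blast
    have t_le: "t \<le> r j" if "j \<in> R" for j unfolding t_def using that by simp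
    have pc: "(p v* A) $ j \<le> c $ j" for j using less.prems by (simp add: less_eq_vec_def)
    have "0 \<le> t" using j0 pc by (simp add: r_def R_def)
    define p1 where "p1 = p + t *\<^sub>R e"
    have p1: "(p1 v* A) $ j = (p v* A) $ j + t * (e v* A) $ j" for j
      unfolding p1_def by (rule vector_matrix_add_scaleR_component)
    have "(p1 v* A) $ j \<le> c $ j" for j
    proof (cases "j \<in> R")
      case True
      with t_le[OF True] show ?thesis by (simp add: p1 r_def R_def field_simps)
    next
      case False
      then have "t * (e v* A) $ j \<le> 0"
        using \<open>0 \<le> t\<close> by (simp add: R_def mult_nonneg_nonpos)
      with pc[of j] show ?thesis by (simp add: p1)
    qed
    then have "p1 v* A \<le> c" by (simp add: less_eq_vec_def)
    moreover have "{j. (p1 v* A) $ j \<noteq> c $ j} \<subset> {j. (p v* A) $ j \<noteq> c $ j}"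
    proof
      show "{j. (p1 v* A) $ j \<noteq> c $ j} \<subseteq> {j. (p v* A) $ j \<noteq> c $ j}"
        using e(1) by (auto simp: p1)
      have "(p1 v* A) $ j0 = c $ j0" using j0 by (simp add: p1 r_def R_def)
      moreover have "(p v* A) $ j0 \<noteq> c $ j0" using j0 e(1) by (auto simp: R_def)
      ultimately show "{j. (p1 v* A) $ j \<noteq> c $ j} \<noteq> {j. (p v* A) $ j \<noteq> c $ j}" by blast
    qed
    then have "card {j. (p1 v* A) $ j \<noteq> c $ j} < card {j. (p v* A) $ j \<noteq> c $ j}"
      by (intro psubset_card_mono) auto
    moreover have "p \<bullet> b \<le> p1 \<bullet> b"
      using e(2) \<open>0 \<le> t\<close> by (simp add: p1_def inner_add_left)
    ultimately show ?thesis using less.hyps[of p1] by (meson order_trans)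
  qed
qed

section \<open>Column selections and basic dual solutions\<close>

lemma column_select_cols: "column k (select_cols A f) = column (f k) A"
  by (simp add: column_def select_cols_def)

lemma columns_select_cols: "columns (select_cols A f) = (\<lambda>j. column j A) ` range f"
  by (auto simp: columns_def column_select_cols)

text \<open>Expresses invertibility through the set of columns alone, which makes it independent of
  how a basis is enumerated.\<close>

lemma invertible_iff_span_columns:
  fixes A :: "real^'n^'n"
  shows "invertible A \<longleftrightarrow> span (columns A) = UNIV"
  using matrix_right_invertible_span_columns[of A] by (simp add: invertible_right_inverse span_vec_eq)

lemma select_cols_comp: "select_cols (select_cols A g) f = select_cols A (g \<circ> f)"
  by (simp add: select_cols_def)

lemma select_entries_comp: "select_entries (select_entries c g) f = select_entries c (g \<circ> f)"
  by (simp add: select_entries_def)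

lemma vector_matrix_select_cols: "p v* select_cols A f = select_entries (p v* A) f"
  by (simp add: select_cols_def select_entries_def vector_matrix_mult_def)

lemma matrix_inv_inverse:
  assumes "invertible A"
  shows "matrix_inv A ** A = mat 1" "A ** matrix_inv A = mat 1"
  using assms someI_ex[of "\<lambda>A'. A ** A' = mat 1 \<and> A' ** A = mat 1"]
  by (auto simp: invertible_def matrix_inv_def)

text \<open>A repeated column would give two unit vectors the same image, so invertibility alone
  forces \<open>f\<close> to be injective. Hence the criterion also applies to selections made
  through a sample with repetitions.\<close>

lemma dual_basic_solutionI:
  fixes A :: "real^'n^'m" and f :: "'m \<Rightarrow> 'n"
  assumes inv: "invertible (select_cols A f)"
    and p: "p v* select_cols A f = select_entries c f"
  shows "dual_basic_solution A c p"
proof -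
  have "inj f"
  proof (rule injI)
    fix i i' assume eq: "f i = f i'"
    have "select_cols A f *v axis i 1 = select_cols A f *v axis i' 1"
      by (simp add: matrix_vector_mult_basis column_select_cols eq)
    moreover have "inj ((*v) (select_cols A f))"
      using inv by (simp add: invertible_eq_bij bij_is_inj)
    ultimately show "i = i'" by (simp add: inj_eq axis_eq_axis)
  qed
  then have bij: "bij_betw f UNIV (range f)" by (simp add: inj_on_imp_bij_betw)
  have "is_basis A (range f)"
    unfolding is_basis_def
  proof (intro conjI allI impI)
    show "card (range f) = CARD('m)" using \<open>inj f\<close> by (rule card_image)
    fix g :: "'m \<Rightarrow> 'n" assume "bij_betw g UNIV (range f)"
    then have "range g = range f" by (simp add: bij_betw_def)
    then show "invertible (select_cols A g)"
      using inv by (simp add: invertible_iff_span_columns columns_select_cols)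
  qed
  moreover have "p = select_entries c f v* matrix_inv (select_cols A f)"
    using matrix_inv_inverse[OF inv] by (simp flip: p add: vector_matrix_mul_assoc)
  ultimately show ?thesis using bij unfolding dual_basic_solution_def by blast
qed

text \<open>If the columns indexed by \<open>S\<close> did not span, some nonzero \<open>d\<close>
  would be orthogonal to all of them. A basis extracted from a spanning set of columns gives the
  square matrix.\<close>

lemma exists_invertible_select_cols:
  fixes A :: "real^'n^'m"
  assumes "\<And>d. (\<And>j. j \<in> S \<Longrightarrow> (d v* A) $ j = 0) \<Longrightarrow> d = 0"
  obtains f :: "'m \<Rightarrow> 'n" where "range f \<subseteq> S" "invertible (select_cols A f)"
proof -
  let ?W = "(\<lambda>j. column j A) ` S"
  have span: "span ?W = UNIV"
  proof (rule ccontr)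
    assume "span ?W \<noteq> UNIV"
    then obtain d where "d \<noteq> 0" and d: "\<And>w. w \<in> span ?W \<Longrightarrow> d \<bullet> w = 0"
      using span_not_univ_subset_hyperplane by blast
    have "(d v* A) $ j = 0" if "j \<in> S" for j
      using d[OF span_base[of "column j A"]] that
      by (auto simp: vector_matrix_mult_def column_def inner_vec_def mult.commute)
    with assms \<open>d \<noteq> 0\<close> show False by blast
  qed
  obtain T where T: "T \<subseteq> ?W" "independent T" "?W \<subseteq> span T" "card T = dim ?W"
    by (rule basis_exists)
  have "span T = UNIV"
    using T(3) span by (metis span_mono span_span top.extremum_uniqueI)
  have "dim ?W = CARD('m)" using span by (metis dim_UNIV dim_span DIM_cart DIM_real mult.right_neutral)
  \<comment> \<open>Different indices may carry equal columns; one index is kept for each basis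
    vector.\<close>
  obtain S' where S': "S' \<subseteq> S" "bij_betw (\<lambda>j. column j A) S' T"
    using T(1) by (metis bij_betw_def subset_image_inj)
  then have "card S' = CARD('m)"
    using T(4) \<open>dim ?W = CARD('m)\<close> by (simp add: bij_betw_same_card)
  then obtain f where f: "bij_betw f (UNIV :: 'm set) S'"
    by (metis finite_class.finite_UNIV finite_same_card_bij finite)
  then have "range f = S'" by (simp add: bij_betw_def)
  with S' \<open>span T = UNIV\<close> show ?thesis
    by (intro that[of f]) (auto simp: invertible_iff_span_columns columns_select_cols bij_betw_def)
qed

text \<open>Ensures that the bound \<open>\<gamma>\<close> applies to at least one vector, which
  yields \<open>0 \<le> \<gamma>\<close>.\<close>

lemma dual_basic_solution_exists:
  fixes A :: "real^'n^'m"
  assumes "rank A = CARD('m)"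
  shows "\<exists>p. dual_basic_solution A c p"
proof -
  obtain f :: "'m \<Rightarrow> 'n" where inv: "invertible (select_cols A f)"
    using exists_invertible_select_cols[of UNIV A] full_row_rank_kernel[OF assms]
    by (metis UNIV_I vec_eq_iff zero_index)
  let ?p = "select_entries c f v* matrix_inv (select_cols A f)"
  have "?p v* select_cols A f = select_entries c f"
    using matrix_inv_inverse[OF inv] by (simp add: vector_matrix_mul_assoc)
  with inv show ?thesis by (blast intro: dual_basic_solutionI)
qed

text \<open>After purification no nonzero direction is orthogonal to all active columns, so the
  active columns contain a basis, and on it the dual constraints hold with equality.\<close>

lemma lp_basic_duality:
  fixes A :: "real^'n^'m" and b :: "real^'m" and c :: "real^'n"
  assumes feas: "std_feasible A b \<noteq> {}" and rank: "rank A = CARD('m)"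
    and above: "\<And>x. x \<in> std_feasible A b \<Longrightarrow> u < c \<bullet> x"
  obtains p and f :: "'m \<Rightarrow> 'n" where "p v* A \<le> c" "u < p \<bullet> b"
    "invertible (select_cols A f)" "p v* select_cols A f = select_entries c f"
proof -
  obtain x0 where x0: "x0 \<in> std_feasible A b" using feas by blast
  obtain p0 where p0: "p0 v* A \<le> c" "u < p0 \<bullet> b"
    using lp_strong_duality[OF x0 above] by blast
  obtain p where p: "p v* A \<le> c" "p0 \<bullet> b \<le> p \<bullet> b"
    "\<And>d. (\<And>j. (p v* A) $ j = c $ j \<Longrightarrow> (d v* A) $ j = 0) \<Longrightarrow> d = 0"
    using dual_purification[OF x0 rank p0(1)] by blast
  obtain f :: "'m \<Rightarrow> 'n" where f: "range f \<subseteq> {j. (p v* A) $ j = c $ j}" "invertible (select_cols A f)"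
    using p(3) by (rule exists_invertible_select_cols[of "{j. (p v* A) $ j = c $ j}"]) auto
  have "p v* select_cols A f = select_entries c f"
    using f(1) by (auto simp: vector_matrix_select_cols select_entries_def)
  with p p0 f show ?thesis by (intro that[of p f]) auto
qed

text \<open>An exact penalty bound: any nonnegative \<open>y\<close>, feasible or not, bounds the
  optimal value once its residual is charged at the largest possible dual price.\<close>

lemma sampled_opt_value_le:
  fixes A :: "real^'n^'m" and b :: "real^'m" and c :: "real^'n" and h :: "'k::finite \<Rightarrow> 'n"
  defines "A\<^sub>J \<equiv> select_cols A h" and "c\<^sub>J \<equiv> select_entries c h"
  assumes gamma: "\<And>p. dual_basic_solution A c p \<Longrightarrow> infnorm p \<le> \<gamma>"
    and feas: "std_feasible A\<^sub>J b \<noteq> {}" and rank: "rank A\<^sub>J = CARD('m)" and y: "0 \<le> y"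
  shows "opt_value c\<^sub>J (std_feasible A\<^sub>J b) \<le> ereal (c\<^sub>J \<bullet> y + \<gamma> * (\<Sum>i\<in>UNIV. \<bar>(A\<^sub>J *v y) $ i - b $ i\<bar>))"
proof -
  \<comment> \<open>The positions \<open>f\<close> of a basis of \<open>A\<^sub>J\<close>, composed
    with the sample \<open>h\<close>, select a basis of \<open>A\<close> itself; this is how
    \<open>\<gamma>\<close> bounds the dual solutions of every sampled problem.\<close>
  have basic: "\<exists>p. p v* A\<^sub>J \<le> c\<^sub>J \<and> u < p \<bullet> b \<and> infnorm p \<le> \<gamma>"
    if above: "\<And>x. x \<in> std_feasible A\<^sub>J b \<Longrightarrow> u < c\<^sub>J \<bullet> x" for u
  proof -
    obtain p and f :: "'m \<Rightarrow> 'k" where p: "p v* A\<^sub>J \<le> c\<^sub>J" "u < p \<bullet> b"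
      "invertible (select_cols A\<^sub>J f)" "p v* select_cols A\<^sub>J f = select_entries c\<^sub>J f"
      using lp_basic_duality[OF feas rank above] by blast
    have "dual_basic_solution A c p"
      using p(3,4) unfolding A\<^sub>J_def c\<^sub>J_def select_cols_comp select_entries_comp
      by (rule dual_basic_solutionI)
    with p gamma show ?thesis by blast
  qed
  let ?R = "c\<^sub>J \<bullet> y + \<gamma> * (\<Sum>i\<in>UNIV. \<bar>(A\<^sub>J *v y) $ i - b $ i\<bar>)"
  show ?thesis
  proof (rule ccontr)
    assume "\<not> ?thesis"
    then have lt: "ereal ?R < opt_value c\<^sub>J (std_feasible A\<^sub>J b)" by simp
    \<comment> \<open>If the claim fails, \<open>?R\<close> itself can serve as the threshold in the
      duality statement.\<close>
    have "?R < c\<^sub>J \<bullet> x" if "x \<in> std_feasible A\<^sub>J b" for x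
    proof -
      have "opt_value c\<^sub>J (std_feasible A\<^sub>J b) \<le> ereal (c\<^sub>J \<bullet> x)"
        unfolding opt_value_def using that by (rule INF_lower)
      with lt have "ereal ?R < ereal (c\<^sub>J \<bullet> x)" by (rule less_le_trans)
      then show ?thesis by simp
    qed
    from basic[OF this] obtain p where p: "p v* A\<^sub>J \<le> c\<^sub>J" "?R < p \<bullet> b" "infnorm p \<le> \<gamma>"
      by blast
    \<comment> \<open>Hoelder's inequality: sup norm of \<open>p\<close> times 1-norm of the
      residual.\<close>
    have "p \<bullet> b - p \<bullet> (A\<^sub>J *v y) = (\<Sum>i\<in>UNIV. p $ i * (b $ i - (A\<^sub>J *v y) $ i))"
      by (simp add: inner_vec_def sum_subtractf algebra_simps)
    also have "\<dots> \<le> (\<Sum>i\<in>UNIV. \<gamma> * \<bar>(A\<^sub>J *v y) $ i - b $ i\<bar>)"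
    proof (rule sum_mono)
      fix i
      have "\<bar>p $ i\<bar> \<le> \<gamma>" using component_le_infnorm_cart[of p i] p(3) by linarith
      then have "\<bar>p $ i\<bar> * \<bar>b $ i - (A\<^sub>J *v y) $ i\<bar> \<le> \<gamma> * \<bar>(A\<^sub>J *v y) $ i - b $ i\<bar>"
        by (simp add: mult_right_mono abs_minus_commute)
      then show "p $ i * (b $ i - (A\<^sub>J *v y) $ i) \<le> \<gamma> * \<bar>(A\<^sub>J *v y) $ i - b $ i\<bar>"
        by (metis abs_ge_self abs_mult order_trans)
    qed
    finally show False
      using weak_duality[OF p(1) y] p(2) by (simp add: sum_distrib_left)
  qed
qed

subsection \<open>Bounded differences for finite product distributions\<close>

lemma integrable_finite_pmf [simp]:
  fixes f :: "'a::finite \<Rightarrow> 'b::{banach, second_countable_topology}"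
  shows "integrable (measure_pmf p) f"
  by (rule integrable_measure_pmf_finite) simp

lemma expectation_finite_pmf:
  fixes f :: "'a::finite \<Rightarrow> real"
  shows "measure_pmf.expectation p f = (\<Sum>t\<in>UNIV. pmf p t * f t)"
  by (subst integral_measure_pmf[of UNIV]) simp_all

text \<open>Fubini for a single coordinate; it drives the inductions for the exponential moment and
  for the second moment.\<close>

lemma expectation_Pi_pmf_insert:
  fixes p :: "'b::finite pmf" and F :: "('a::finite \<Rightarrow> 'b) \<Rightarrow> real"
  assumes "x \<notin> A"
  shows "measure_pmf.expectation (Pi_pmf (insert x A) dflt (\<lambda>_. p)) F =
    measure_pmf.expectation p
      (\<lambda>y. measure_pmf.expectation (Pi_pmf A dflt (\<lambda>_. p)) (\<lambda>h. F (h(x := y))))"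
proof -
  have "measure_pmf.expectation (Pi_pmf (insert x A) dflt (\<lambda>_. p)) F =
     measure_pmf.expectation (p \<bind> (\<lambda>y. map_pmf (\<lambda>h. h(x := y)) (Pi_pmf A dflt (\<lambda>_. p)))) F"
    using assms by (simp add: Pi_pmf_insert' map_pmf_def)
  also have "\<dots> = (\<Sum>y\<in>UNIV. pmf p y *\<^sub>R
      measure_pmf.expectation (map_pmf (\<lambda>h. h(x := y)) (Pi_pmf A dflt (\<lambda>_. p))) F)"
    by (rule pmf_expectation_bind) auto
  finally show ?thesis by (simp add: expectation_finite_pmf[of p])
qed

text \<open>Restates Hoeffding's lemma with the oscillation \<open>d\<close> in place of an
  enclosing interval: \<open>[a, a + d]\<close> works for the minimum \<open>a\<close> of
  \<open>g\<close>.\<close>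

lemma Hoeffdings_lemma_finite_pmf:
  fixes g :: "'b::finite \<Rightarrow> real"
  assumes s: "0 < s" and g: "\<And>t t'. g t - g t' \<le> d"
  shows "measure_pmf.expectation p (\<lambda>t. exp (s * g t))
    \<le> exp (s * measure_pmf.expectation p g + s\<^sup>2 * d\<^sup>2 / 8)"
proof -
  define a where "a = Min (range g)"
  have "a \<in> range g" unfolding a_def by (intro Min_in) auto
  then have le: "g t \<le> a + d" for t using g[of t] by (force simp: algebra_simps)
  have ge: "a \<le> g t" for t unfolding a_def by simp
  interpret interval_bounded_random_variable "measure_pmf p" g a "a + d"
    by unfold_locales (auto simp: le ge)
  let ?\<mu> = "measure_pmf.expectation p g"
  have "(\<integral>\<^sup>+t. ennreal (exp (s * (g t - ?\<mu>))) \<partial>measure_pmf p) \<le> ennreal (exp (s\<^sup>2 * d\<^sup>2 / 8))"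
    using Hoeffdings_lemma_nn_integral[OF s] by simp
  moreover have "(\<integral>\<^sup>+t. ennreal (exp (s * (g t - ?\<mu>))) \<partial>measure_pmf p) =
      ennreal (measure_pmf.expectation p (\<lambda>t. exp (s * (g t - ?\<mu>))))"
    by (rule nn_integral_eq_integral) simp_all
  ultimately have "measure_pmf.expectation p (\<lambda>t. exp (s * (g t - ?\<mu>))) \<le> exp (s\<^sup>2 * d\<^sup>2 / 8)"
    by simp
  moreover have "measure_pmf.expectation p (\<lambda>t. exp (s * g t)) =
      exp (s * ?\<mu>) * measure_pmf.expectation p (\<lambda>t. exp (s * (g t - ?\<mu>)))"
  proof -
    have "exp (s * g t) = exp (s * ?\<mu>) * exp (s * (g t - ?\<mu>))" for t
      by (simp add: right_diff_distrib flip: exp_add)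
    then show ?thesis by (simp only: integral_mult_right_zero)
  qed
  ultimately show ?thesis by (simp add: exp_add)
qed

text \<open>Induction over the coordinates replaces the martingale argument: each new coordinate
  contributes one factor from Hoeffding's lemma.\<close>

lemma Pi_pmf_mgf_bounded_differences:
  fixes p :: "'b::finite pmf" and F :: "('a::finite \<Rightarrow> 'b) \<Rightarrow> real" and d :: real
  assumes s: "0 < s"
    and diff: "\<And>h k t t'. k \<in> A \<Longrightarrow> F (h(k := t)) - F (h(k := t')) \<le> d"
  shows "measure_pmf.expectation (Pi_pmf A dflt (\<lambda>_. p)) (\<lambda>h. exp (s * F h))
    \<le> exp (s * measure_pmf.expectation (Pi_pmf A dflt (\<lambda>_. p)) F + s\<^sup>2 * (card A * d\<^sup>2) / 8)"
  using finite[of A] diff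
proof (induction A arbitrary: F rule: finite_induct)
  case empty
  then show ?case by simp
next
  case (insert x A)
  let ?E = "measure_pmf.expectation (Pi_pmf A dflt (\<lambda>_. p))"
  let ?v = "s\<^sup>2 * (card A * d\<^sup>2) / 8"
  \<comment> \<open>\<open>G\<close> averages out the old coordinates and inherits the oscillation
    bound in the new one; the induction hypothesis handles the old coordinates with the new one
    frozen.\<close>
  define G where "G y = ?E (\<lambda>h. F (h(x := y)))" for y
  have G: "G y - G y' \<le> d" for y y'
  proof -
    have "G y - G y' = ?E (\<lambda>h. F (h(x := y)) - F (h(x := y')))"
      by (simp add: G_def)
    also have "\<dots> \<le> ?E (\<lambda>_. d)"
      by (intro integral_mono) (auto intro: insert.prems)
    finally show ?thesis by simp
  qed
  have "measure_pmf.expectation (Pi_pmf (insert x A) dflt (\<lambda>_. p)) (\<lambda>h. exp (s * F h)) =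
      measure_pmf.expectation p (\<lambda>y. ?E (\<lambda>h. exp (s * F (h(x := y)))))"
    by (rule expectation_Pi_pmf_insert) fact
  also have "\<dots> \<le> measure_pmf.expectation p (\<lambda>y. exp (s * G y + ?v))"
  proof (intro integral_mono)
    fix y
    show "?E (\<lambda>h. exp (s * F (h(x := y)))) \<le> exp (s * G y + ?v)"
      unfolding G_def
    proof (rule insert.IH)
      fix h :: "'a \<Rightarrow> 'b" and k t t' assume "k \<in> A"
      with \<open>x \<notin> A\<close> have "(h(k := u))(x := y) = (h(x := y))(k := u)" for u
        by (auto simp: fun_upd_twist)
      then show "F ((h(k := t))(x := y)) - F ((h(k := t'))(x := y)) \<le> d"
        using insert.prems[of k "h(x := y)" t t'] \<open>k \<in> A\<close> by (simp del: fun_upd_apply)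
    qed
  qed simp_all
  also have "\<dots> = exp ?v * measure_pmf.expectation p (\<lambda>y. exp (s * G y))"
    by (simp only: exp_add mult.commute[of "exp ?v"] integral_mult_left_zero)
  also have "\<dots> \<le> exp ?v * exp (s * measure_pmf.expectation p G + s\<^sup>2 * d\<^sup>2 / 8)"
    by (intro mult_left_mono Hoeffdings_lemma_finite_pmf s G) simp
  also have "\<dots> = exp (s * measure_pmf.expectation p G + s\<^sup>2 * (card (insert x A) * d\<^sup>2) / 8)"
    using insert.hyps by (simp flip: exp_add add: field_simps)
  also have "measure_pmf.expectation p G =
      measure_pmf.expectation (Pi_pmf (insert x A) dflt (\<lambda>_. p)) F"
    unfolding G_def using insert.hyps by (simp add: expectation_Pi_pmf_insert)
  finally show ?case .
qed

text \<open>McDiarmid's inequality, by the Chernoff method from the exponential moment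
  bound.\<close>

lemma Pi_pmf_mcdiarmid:
  fixes p :: "'b::finite pmf" and dflt :: 'b and F :: "('a::finite \<Rightarrow> 'b) \<Rightarrow> real"
  assumes diff: "\<And>h k t t'. F (h(k := t)) - F (h(k := t')) \<le> d" and d: "0 < d"
    and \<delta>: "0 < \<delta>" "\<delta> < 1"
  defines "Q \<equiv> Pi_pmf UNIV dflt (\<lambda>_. p)"
  shows "1 - \<delta> \<le> measure_pmf.prob Q
    {h. F h \<le> measure_pmf.expectation Q F + d * sqrt (CARD('a) * ln (1 / \<delta>) / 2)}"
proof -
  define K where "K = real CARD('a)"
  define L where "L = ln (1 / \<delta>)"
  \<comment> \<open>\<open>t\<close> solves \<open>2 * t\<^sup>2 / (K * d\<^sup>2) = L\<close>, and
    \<open>s\<close> minimizes the exponent \<open>s\<^sup>2 * (K * d\<^sup>2) / 8 - s * t\<close>,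
    so that the tail is exactly \<open>\<delta>\<close>.\<close>
  define t where "t = d * sqrt (K * L / 2)"
  define s where "s = 4 * t / (K * d\<^sup>2)"
  define \<mu> where "\<mu> = measure_pmf.expectation Q F"
  have K: "0 < K" by (simp add: K_def)
  have L: "0 < L" using \<delta> by (simp add: L_def)
  have t: "0 < t" using d K L by (simp add: t_def)
  have t2: "t\<^sup>2 = d\<^sup>2 * (K * L / 2)" using K L by (simp add: t_def power_mult_distrib)
  have s: "0 < s" using t K d by (simp add: s_def)
  have expo: "s * \<mu> + s\<^sup>2 * (K * d\<^sup>2) / 8 - s * (\<mu> + t) = - L"
  proof -
    have "s * \<mu> + s\<^sup>2 * (K * d\<^sup>2) / 8 - s * (\<mu> + t) = - (2 * t\<^sup>2 / (K * d\<^sup>2))"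
      using K d by (simp add: s_def power2_eq_square field_simps)
    also have "\<dots> = - L" unfolding t2 using K d by (simp add: field_simps)
    finally show ?thesis .
  qed
  have "measure_pmf.prob Q {h. \<mu> + t < F h} \<le> measure_pmf.prob Q {h. exp (s * (\<mu> + t)) \<le> exp (s * F h)}"
    using s by (intro measure_pmf.finite_measure_mono) auto
  also have "\<dots> \<le> measure_pmf.expectation Q (\<lambda>h. exp (s * F h)) / exp (s * (\<mu> + t))"
    using integral_Markov_inequality_measure[of "measure_pmf Q" "\<lambda>h. exp (s * F h)" UNIV "exp (s * (\<mu> + t))"]
    by simp
  also have "\<dots> \<le> exp (s * \<mu> + s\<^sup>2 * (K * d\<^sup>2) / 8) / exp (s * (\<mu> + t))"
    unfolding \<mu>_def Q_def K_def
    by (intro divide_right_mono Pi_pmf_mgf_bounded_differences s diff) simp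
  also have "\<dots> = \<delta>"
    using expo \<delta> by (simp flip: exp_diff add: L_def ln_div)
  finally have "measure_pmf.prob Q {h. \<mu> + t < F h} \<le> \<delta>" .
  moreover have "measure_pmf.prob Q {h. F h \<le> \<mu> + t} = 1 - measure_pmf.prob Q {h. \<mu> + t < F h}"
    by (subst measure_pmf.prob_compl[symmetric, simplified])
       (auto intro!: arg_cong[of _ _ "measure_pmf.prob Q"])
  ultimately show ?thesis by (simp add: \<mu>_def t_def K_def L_def)
qed

section \<open>Moments and concentration of sample means\<close>

lemma expectation_sum_Pi_pmf:
  fixes p :: "'b::finite pmf" and g :: "'b \<Rightarrow> real" and A :: "'a::finite set"
  shows "measure_pmf.expectation (Pi_pmf A dflt (\<lambda>_. p)) (\<lambda>h. \<Sum>k\<in>A. g (h k)) =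
    card A * measure_pmf.expectation p g"
proof -
  have "measure_pmf.expectation (Pi_pmf A dflt (\<lambda>_. p)) (\<lambda>h. g (h k)) = measure_pmf.expectation p g"
    if "k \<in> A" for k
  proof -
    have "measure_pmf.expectation (Pi_pmf A dflt (\<lambda>_. p)) (\<lambda>h. g (h k)) =
        measure_pmf.expectation (map_pmf (\<lambda>h. h k) (Pi_pmf A dflt (\<lambda>_. p))) g" by simp
    then show ?thesis using that by (subst (asm) Pi_pmf_component) auto
  qed
  then show ?thesis by simp
qed

text \<open>Centred independent terms are orthogonal: when a coordinate is added, the cross term
  carries the factor \<open>?E ?S = 0\<close>.\<close>

lemma expectation_sum_squared_Pi_pmf:
  fixes p :: "'b::finite pmf" and Z :: "'b \<Rightarrow> real" and A :: "'a::finite set"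
  assumes Z: "measure_pmf.expectation p Z = 0"
  shows "measure_pmf.expectation (Pi_pmf A dflt (\<lambda>_. p)) (\<lambda>h. (\<Sum>k\<in>A. Z (h k))\<^sup>2) =
    card A * measure_pmf.expectation p (\<lambda>t. (Z t)\<^sup>2)"
  using finite[of A]
proof (induction A rule: finite_induct)
  case empty
  then show ?case by simp
next
  case (insert x A)
  let ?E = "measure_pmf.expectation (Pi_pmf A dflt (\<lambda>_. p))"
  let ?S = "\<lambda>h. \<Sum>k\<in>A. Z (h k)"
  have mean: "?E ?S = 0" by (simp only: expectation_sum_Pi_pmf Z)
  have S: "(\<Sum>k\<in>insert x A. Z ((h(x := y)) k)) = Z y + ?S h" for h y
  proof -
    have "(\<Sum>k\<in>A. Z ((h(x := y)) k)) = ?S h" using insert.hyps by (intro sum.cong) auto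
    then show ?thesis using insert.hyps by simp
  qed
  have "measure_pmf.expectation (Pi_pmf (insert x A) dflt (\<lambda>_. p))
      (\<lambda>h. (\<Sum>k\<in>insert x A. Z (h k))\<^sup>2) =
    measure_pmf.expectation p (\<lambda>y. ?E (\<lambda>h. (Z y + ?S h)\<^sup>2))"
    by (simp only: expectation_Pi_pmf_insert[OF \<open>x \<notin> A\<close>] S)
  also have "\<dots> = measure_pmf.expectation p (\<lambda>y. (Z y)\<^sup>2 + ?E (\<lambda>h. (?S h)\<^sup>2))"
  proof (intro Bochner_Integration.integral_cong refl)
    fix y
    have "?E (\<lambda>h. (Z y + ?S h)\<^sup>2) = ?E (\<lambda>h. (Z y)\<^sup>2 + (2 * Z y * ?S h + (?S h)\<^sup>2))"
      by (simp add: power2_sum algebra_simps)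
    also have "\<dots> = (Z y)\<^sup>2 + (2 * Z y * ?E ?S + ?E (\<lambda>h. (?S h)\<^sup>2))"
      by (simp only: Bochner_Integration.integral_add integrable_finite_pmf
        integral_mult_right_zero lebesgue_integral_const measure_pmf.prob_space) simp
    finally show "?E (\<lambda>h. (Z y + ?S h)\<^sup>2) = (Z y)\<^sup>2 + ?E (\<lambda>h. (?S h)\<^sup>2)"
      by (simp only: mean mult_zero_right add_0)
  qed
  also have "\<dots> = measure_pmf.expectation p (\<lambda>t. (Z t)\<^sup>2) + ?E (\<lambda>h. (?S h)\<^sup>2)" by simp
  finally show ?case using insert by (simp add: algebra_simps)
qed

definition sample_mean :: "('b \<Rightarrow> real) \<Rightarrow> ('a::finite \<Rightarrow> 'b) \<Rightarrow> real" where
  "sample_mean g h = (\<Sum>k\<in>UNIV. g (h k)) / CARD('a)"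

lemma sample_mean_update:
  fixes h :: "'a::finite \<Rightarrow> 'b" and B :: real
  assumes "\<And>t. \<bar>g t\<bar> \<le> B"
  shows "\<bar>sample_mean g (h(k := t)) - sample_mean g (h(k := t'))\<bar> \<le> 2 * B / CARD('a)"
proof -
  have "(\<Sum>i\<in>UNIV. g ((h(k := u)) i)) = g u + (\<Sum>i\<in>UNIV - {k}. g (h i))" for u
    by (subst sum.remove[of _ k]) (auto intro!: sum.cong)
  then have "sample_mean g (h(k := t)) - sample_mean g (h(k := t')) = (g t - g t') / CARD('a)"
    by (simp add: sample_mean_def field_simps del: fun_upd_apply)
  moreover have "\<bar>g t - g t'\<bar> \<le> 2 * B" using assms[of t] assms[of t'] by linarith
  ultimately show ?thesis by (simp add: divide_right_mono)
qed

lemma expectation_sample_mean: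
  fixes p :: "'b::finite pmf" and dflt :: 'b
  defines "Q \<equiv> Pi_pmf (UNIV :: 'a::finite set) dflt (\<lambda>_. p)"
  shows "measure_pmf.expectation Q (sample_mean g) = measure_pmf.expectation p g"
proof -
  have "measure_pmf.expectation Q (sample_mean g) =
      measure_pmf.expectation Q (\<lambda>h. \<Sum>k\<in>UNIV. g (h k)) / CARD('a)"
    unfolding sample_mean_def[abs_def] by (rule integral_divide_zero)
  then show ?thesis unfolding Q_def expectation_sum_Pi_pmf by simp
qed

text \<open>The mean of \<open>CARD('a)\<close> independent terms has \<open>1 / CARD('a)\<close> of
  the variance of one term, which is at most \<open>B\<^sup>2\<close>; the first absolute moment is
  bounded by the root of the second.\<close>

lemma expectation_sample_mean_deviation:
  fixes p :: "'b::finite pmf" and dflt :: 'b and g :: "'b \<Rightarrow> real" and B :: real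
  defines "Q \<equiv> Pi_pmf (UNIV :: 'a::finite set) dflt (\<lambda>_. p)" and "\<mu> \<equiv> measure_pmf.expectation p g"
  assumes B: "\<And>t. \<bar>g t\<bar> \<le> B"
  shows "measure_pmf.expectation Q (\<lambda>h. \<bar>sample_mean g h - \<mu>\<bar>) \<le> B / sqrt CARD('a)"
proof -
  define Z where "Z t = g t - \<mu>" for t
  let ?K = "real CARD('a)"
  let ?D = "\<lambda>h. \<bar>sample_mean g h - \<mu>\<bar>"
  have B0: "0 \<le> B" using B abs_ge_zero order_trans by blast
  have Z: "measure_pmf.expectation p Z = 0" by (simp add: Z_def[abs_def] \<mu>_def)
  have "measure_pmf.expectation p (\<lambda>t. (Z t)\<^sup>2) =
      measure_pmf.expectation p (\<lambda>t. (g t)\<^sup>2) - \<mu>\<^sup>2"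
    unfolding Z_def \<mu>_def by (rule measure_pmf.variance_eq) simp_all
  also have "\<dots> \<le> measure_pmf.expectation p (\<lambda>t. B\<^sup>2)"
  proof -
    have "measure_pmf.expectation p (\<lambda>t. (g t)\<^sup>2) \<le> measure_pmf.expectation p (\<lambda>t. B\<^sup>2)"
      using B by (intro integral_mono) (auto simp: abs_le_square_iff[symmetric] B0)
    then show ?thesis by (smt (verit) zero_le_power2)
  qed
  finally have var: "measure_pmf.expectation p (\<lambda>t. (Z t)\<^sup>2) \<le> B\<^sup>2" by simp
  have D: "(?D h)\<^sup>2 = (\<Sum>k\<in>UNIV. Z (h k))\<^sup>2 / ?K\<^sup>2" for h :: "'a \<Rightarrow> 'b"
  proof -
    have "sample_mean g h - \<mu> = (\<Sum>k\<in>UNIV. Z (h k)) / ?K"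
      by (simp add: sample_mean_def Z_def sum_subtractf field_simps)
    then show ?thesis by (simp add: power_divide)
  qed
  \<comment> \<open>Jensen's inequality, in the form that the variance of \<open>?D\<close> is
    nonnegative.\<close>
  have "(measure_pmf.expectation Q ?D)\<^sup>2 \<le> measure_pmf.expectation Q (\<lambda>h. (?D h)\<^sup>2)"
    using measure_pmf.variance_eq[of Q ?D] measure_pmf.variance_positive[of Q ?D] by simp
  also have "\<dots> = measure_pmf.expectation Q (\<lambda>h. (\<Sum>k\<in>UNIV. Z (h k))\<^sup>2) / ?K\<^sup>2"
    unfolding D by (rule integral_divide_zero)
  also have "\<dots> = measure_pmf.expectation p (\<lambda>t. (Z t)\<^sup>2) / ?K"
    unfolding Q_def expectation_sum_squared_Pi_pmf[OF Z] by (simp add: power2_eq_square)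
  also have "\<dots> \<le> B\<^sup>2 / ?K" using var by (simp add: divide_right_mono)
  also have "\<dots> = (B / sqrt ?K)\<^sup>2" by (simp add: power_divide)
  finally show ?thesis by (rule power2_le_imp_le) (simp add: B0)
qed

text \<open>Cost and penalty form one function, so a single application of McDiarmid's inequality
  suffices and no union bound over the rows is taken. The constant \<open>L\<close> controls both
  the bias, at most \<open>L / sqrt CARD('a)\<close>, and the differences, at most
  \<open>2 * L / CARD('a)\<close>.\<close>

lemma sample_means_concentration:
  fixes p :: "'b::finite pmf" and dflt :: 'b and f :: "'b \<Rightarrow> real" and g :: "'m::finite \<Rightarrow> 'b \<Rightarrow> real"
    and C B \<gamma> \<delta> :: real
  assumes f: "\<And>t. \<bar>f t\<bar> \<le> C" and g: "\<And>i t. \<bar>g i t\<bar> \<le> B" and \<gamma>: "0 \<le> \<gamma>"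
    and C: "0 < C" and \<delta>: "0 < \<delta>" "\<delta> < 1"
  defines "Q \<equiv> Pi_pmf (UNIV :: 'a::finite set) dflt (\<lambda>_. p)"
    and "L \<equiv> C + \<gamma> * CARD('m) * B"
  shows "1 - \<delta> \<le> measure_pmf.prob Q {h.
    sample_mean f h + \<gamma> * (\<Sum>i\<in>UNIV. \<bar>sample_mean (g i) h - measure_pmf.expectation p (g i)\<bar>)
      \<le> measure_pmf.expectation p f + L / sqrt CARD('a) * (1 + sqrt (2 * ln (1 / \<delta>)))}"
proof -
  define D where "D i h = \<bar>sample_mean (g i) h - measure_pmf.expectation p (g i)\<bar>" for i and h :: "'a \<Rightarrow> 'b"
  define F where "F h = sample_mean f h + \<gamma> * (\<Sum>i\<in>UNIV. D i h)" for h
  let ?K = "real CARD('a)"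
  have "0 \<le> B" using g abs_ge_zero order_trans by blast
  then have L: "C \<le> L" using \<gamma> by (simp add: L_def)
  have mono: "y / sqrt ?K \<le> L / sqrt ?K" if "y \<le> L" for y using that by (simp add: divide_right_mono)
  \<comment> \<open>The cost term is unbiased; only the \<open>CARD('m)\<close> absolute deviations
    contribute to the excess.\<close>
  have mean: "measure_pmf.expectation Q F \<le> measure_pmf.expectation p f + L / sqrt ?K"
  proof -
    have "measure_pmf.expectation Q F =
        measure_pmf.expectation Q (sample_mean f) + \<gamma> * (\<Sum>i\<in>UNIV. measure_pmf.expectation Q (D i))"
      unfolding F_def[abs_def] by simp
    also have "measure_pmf.expectation Q (sample_mean f) = measure_pmf.expectation p f"
      unfolding Q_def by (rule expectation_sample_mean)
    also have "(\<Sum>i\<in>UNIV. measure_pmf.expectation Q (D i)) \<le> (\<Sum>i\<in>(UNIV :: 'm set). B / sqrt ?K)"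
      unfolding D_def[abs_def] Q_def by (intro sum_mono expectation_sample_mean_deviation g)
    finally have "measure_pmf.expectation Q F \<le>
        measure_pmf.expectation p f + \<gamma> * (CARD('m) * (B / sqrt ?K))"
      using \<gamma> by (simp add: mult_left_mono)
    also have "\<gamma> * (CARD('m) * (B / sqrt ?K)) \<le> L / sqrt ?K"
      using mono[of "\<gamma> * CARD('m) * B"] C by (simp add: L_def)
    finally show ?thesis by simp
  qed
  have diff: "F (h(k := t)) - F (h(k := t')) \<le> 2 * L / ?K" for h k t t'
  proof -
    let ?h = "h(k := t)" and ?h' = "h(k := t')"
    have "(\<Sum>i\<in>UNIV. D i ?h) - (\<Sum>i\<in>UNIV. D i ?h') \<le> (\<Sum>i\<in>(UNIV :: 'm set). 2 * B / ?K)"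
      unfolding sum_subtractf[symmetric]
    proof (rule sum_mono)
      fix i
      show "D i ?h - D i ?h' \<le> 2 * B / ?K"
        using sample_mean_update[of "g i" B h k t t', OF g] unfolding D_def by linarith
    qed
    then have "\<gamma> * ((\<Sum>i\<in>UNIV. D i ?h) - (\<Sum>i\<in>UNIV. D i ?h')) \<le> \<gamma> * (CARD('m) * (2 * B / ?K))"
      using \<gamma> by (intro mult_left_mono) simp_all
    moreover have "sample_mean f ?h - sample_mean f ?h' \<le> 2 * C / ?K"
      using sample_mean_update[of f C h k t t', OF f] by linarith
    moreover have "2 * C / ?K + \<gamma> * (CARD('m) * (2 * B / ?K)) = 2 * L / ?K"
      by (simp add: L_def field_simps)
    ultimately show ?thesis unfolding F_def by (simp add: algebra_simps)
  qed
  \<comment> \<open>The deviation term of McDiarmid's inequality for differences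
    \<open>2 * L / ?K\<close>, simplified by writing \<open>?K\<close> as the square of its
    root.\<close>
  have dev: "2 * L / ?K * sqrt (?K * ln (1 / \<delta>) / 2) = L / sqrt ?K * sqrt (2 * ln (1 / \<delta>))"
  proof -
    have "sqrt (?K * ln (1 / \<delta>) / 2) = sqrt ?K * sqrt (2 * ln (1 / \<delta>)) / 2"
      by (simp add: real_sqrt_mult real_sqrt_divide real_div_sqrt field_simps)
    moreover have "2 * L / (q * q) * (q * y / 2) = L / q * y" if "0 < q" for q y :: real
      using that by simp
    from this[of "sqrt ?K"] have "2 * L / ?K * (sqrt ?K * y / 2) = L / sqrt ?K * y" for y
      by simp
    ultimately show ?thesis by (simp only:)
  qed
  have "1 - \<delta> \<le> measure_pmf.prob Q
      {h. F h \<le> measure_pmf.expectation Q F + 2 * L / ?K * sqrt (?K * ln (1 / \<delta>) / 2)}"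
    unfolding Q_def using L C by (intro Pi_pmf_mcdiarmid diff \<delta>) simp
  also have "\<dots> \<le> measure_pmf.prob Q
      {h. F h \<le> measure_pmf.expectation p f + L / sqrt ?K * (1 + sqrt (2 * ln (1 / \<delta>)))}"
    unfolding dev using mean by (intro measure_pmf.finite_measure_mono) (auto simp: distrib_left)
  finally show ?thesis by (simp add: F_def D_def)
qed

section \<open>Transfer to an arbitrary probability space\<close>

text \<open>There are finitely many samples, so comparing point masses is enough, and independence
  factors each joint point mass into its marginals.\<close>

lemma (in prob_space) prob_indep_vars_Pi_pmf:
  fixes X :: "'k::finite \<Rightarrow> 'a \<Rightarrow> 'n::finite"
  assumes indep: "indep_vars (\<lambda>_. count_space UNIV) X UNIV"
    and distr: "\<And>k t. prob {\<omega> \<in> space M. X k \<omega> = t} = pmf p t"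
  shows "prob {\<omega> \<in> space M. P (\<lambda>k. X k \<omega>)} = measure_pmf.prob (Pi_pmf UNIV dflt (\<lambda>_. p)) {h. P h}"
proof -
  define E where "E h = {\<omega> \<in> space M. (\<lambda>k. X k \<omega>) = h}" for h
  have E: "E h = (\<Inter>k\<in>UNIV. X k -` {h k} \<inter> space M)" for h
    by (auto simp: E_def fun_eq_iff)
  have meas: "X k \<in> measurable M (count_space UNIV)" for k
    using indep by (simp add: indep_vars_def)
  have ev: "E h \<in> events" for h
    unfolding E by (intro sets.finite_INT measurable_sets[OF meas]) simp_all
  have "{\<omega> \<in> space M. P (\<lambda>k. X k \<omega>)} = (\<Union>h\<in>{h. P h}. E h)"
    by (simp add: E_def set_eq_iff)
  then have "prob {\<omega> \<in> space M. P (\<lambda>k. X k \<omega>)} = prob (\<Union>h\<in>{h. P h}. E h)"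
    by (rule arg_cong)
  also have "\<dots> = (\<Sum>h\<in>{h. P h}. prob (E h))"
  proof (rule finite_measure_finite_Union)
    show "E ` {h. P h} \<subseteq> events" using ev by blast
    show "disjoint_family_on E {h. P h}" by (auto simp: disjoint_family_on_def E_def)
  qed simp
  also have "\<dots> = (\<Sum>h\<in>{h. P h}. pmf (Pi_pmf UNIV dflt (\<lambda>_. p)) h)"
  proof (intro sum.cong refl)
    fix h :: "'k \<Rightarrow> 'n"
    have "prob (E h) = (\<Prod>k\<in>UNIV. prob (X k -` {h k} \<inter> space M))"
      unfolding E by (rule indep_varsD[OF indep]) simp_all
    also have "\<dots> = (\<Prod>k\<in>UNIV. prob {\<omega> \<in> space M. X k \<omega> = h k})"
      by (intro prod.cong refl arg_cong[of _ _ prob]) blast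
    finally show "prob (E h) = pmf (Pi_pmf UNIV dflt (\<lambda>_. p)) h"
      by (simp add: pmf_Pi distr)
  qed
  also have "\<dots> = measure_pmf.prob (Pi_pmf UNIV dflt (\<lambda>_. p)) {h. P h}"
    by (rule measure_measure_pmf_finite[symmetric]) simp
  finally show ?thesis .
qed

subsection \<open>The column-randomized linear program\<close>

text \<open>Finiteness of \<open>v(P)\<close> is what allows it to be subtracted and cancelled on
  \<open>ereal\<close>.\<close>

lemma opt_value_eq_ereal:
  assumes "X \<noteq> {}" "bdd_below ((\<lambda>x. c \<bullet> x) ` X)"
  obtains v where "opt_value c X = ereal v"
proof -
  obtain l where l: "\<And>x. x \<in> X \<Longrightarrow> l \<le> c \<bullet> x" using assms(2) by (auto simp: bdd_below_def)
  obtain x where "x \<in> X" using assms(1) by blast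
  then have "opt_value c X \<le> ereal (c \<bullet> x)" unfolding opt_value_def by (rule INF_lower)
  moreover have "ereal l \<le> opt_value c X" unfolding opt_value_def using l by (intro INF_greatest) simp
  ultimately show ?thesis by (cases "opt_value c X") (auto intro: that)
qed

text \<open>The upper bounds on \<open>x\<close> confine the feasible set to a box, so it is
  compact.\<close>

lemma distr_opt_attained:
  fixes A :: "real^'n^'m"
  assumes "distr_feasible A b C \<xi> \<noteq> {}"
  obtains x where "x \<in> distr_feasible A b C \<xi>" "opt_value c (distr_feasible A b C \<xi>) = ereal (c \<bullet> x)"
proof -
  let ?X = "distr_feasible A b C \<xi>"
  have "?X = {x. A *v x = b} \<inter> cbox 0 (C *\<^sub>R \<xi>)"
    by (auto simp: distr_feasible_def less_eq_vec_def mem_box_cart)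
  moreover have "closed {x. A *v x = b}"
    by (intro closed_Collect_eq continuous_intros matrix_vector_mult_linear_continuous_on)
  ultimately have "compact ?X" by (simp add: closed_Int_compact)
  moreover have "continuous_on ?X (\<lambda>x. c \<bullet> x)" by (intro continuous_intros)
  ultimately obtain x where x: "x \<in> ?X" "\<And>y. y \<in> ?X \<Longrightarrow> c \<bullet> x \<le> c \<bullet> y"
    using continuous_attains_inf[of ?X "\<lambda>x. c \<bullet> x"] assms by blast
  have "opt_value c ?X = ereal (c \<bullet> x)"
    unfolding opt_value_def using x by (intro antisym INF_lower INF_greatest) auto
  with x show ?thesis by (intro that)
qed

lemma abs_entry_le_max_norm: "\<bar>A $ i $ j\<bar> \<le> max_norm A"
proof -
  have "{\<bar>A $ i $ j\<bar> | i j. True} = (\<lambda>(i, j). \<bar>A $ i $ j\<bar>) ` UNIV" by auto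
  then have "finite {\<bar>A $ i $ j\<bar> | i j. True}" by simp
  then show ?thesis unfolding max_norm_def by (intro Max_ge) auto
qed

theorem theorem1:
  fixes A :: "real^'n^'m" and b :: "real^'m" and c :: "real^'n"
    and \<xi> :: "real^'n" and C \<gamma> \<delta> :: real
    and M :: "'w measure" and j :: "'k::finite \<Rightarrow> 'w \<Rightarrow> 'n"
  assumes P_feasible: "std_feasible A b \<noteq> {}"
    and P_bounded: "bdd_below ((\<lambda>x. c \<bullet> x) ` std_feasible A b)"
    and rank_A: "rank A = CARD('m)"
    and norm_c: "norm c = 1"
    and xi_nonneg: "\<And>t. 0 \<le> \<xi> $ t"
    and xi_sum: "(\<Sum>t\<in>UNIV. \<xi> $ t) = 1"
    and C_pos: "0 < C"
    and gamma: "\<And>p. dual_basic_solution A c p \<Longrightarrow> infnorm p \<le> \<gamma>"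
    and M: "prob_space M"
    and indep: "prob_space.indep_vars M (\<lambda>_. count_space UNIV) j UNIV"
    and distribution: "\<And>k t. measure M {\<omega> \<in> space M. j k \<omega> = t} = \<xi> $ t"
    and delta: "0 < \<delta>" "\<delta> < 1"
  shows "measure M {\<omega> \<in> space M.
      (let A\<^sub>J = select_cols A (\<lambda>k. j k \<omega>); c\<^sub>J = select_entries c (\<lambda>k. j k \<omega>) in
        std_feasible A\<^sub>J b \<noteq> {} \<and> rank A\<^sub>J = CARD('m) \<longrightarrow>
        opt_value c\<^sub>J (std_feasible A\<^sub>J b) - opt_value c (std_feasible A b)
          \<le> opt_value c (distr_feasible A b C \<xi>) - opt_value c (std_feasible A b)
            + ereal (C * (1 + real CARD('m) * \<gamma> * max_norm A) / sqrt (real CARD('k))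
                * (1 + sqrt (2 * ln (2 / \<delta>)))))}
    \<ge> 1 - \<delta>"
proof -
  interpret prob_space M by (rule M)
  let ?vP = "opt_value c (std_feasible A b)"
  let ?vD = "opt_value c (distr_feasible A b C \<xi>)"
  let ?T = "\<lambda>l. C * (1 + real CARD('m) * \<gamma> * max_norm A) / sqrt (real CARD('k)) * (1 + sqrt (2 * l))"
  \<comment> \<open>The event depends on \<open>\<omega>\<close> only through the sample, so it is
    stated for index maps \<open>h\<close> and can be evaluated under the product
    distribution.\<close>
  define P where "P h \<longleftrightarrow> (let A\<^sub>J = select_cols A h; c\<^sub>J = select_entries c h in
    std_feasible A\<^sub>J b \<noteq> {} \<and> rank A\<^sub>J = CARD('m) \<longrightarrow>
      opt_value c\<^sub>J (std_feasible A\<^sub>J b) - ?vP \<le> ?vD - ?vP + ereal (?T (ln (2 / \<delta>))))"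
    for h :: "'k \<Rightarrow> 'n"
  obtain v where v: "?vP = ereal v"
    using opt_value_eq_ereal[OF P_feasible P_bounded] .
  have "1 - \<delta> \<le> prob {\<omega> \<in> space M. P (\<lambda>k. j k \<omega>)}"
  proof (cases "distr_feasible A b C \<xi> = {}")
    case True
    \<comment> \<open>The right-hand side is infinite here, so every sample satisfies the
      bound.\<close>
    then have "P h" for h by (simp add: P_def v opt_value_def top_ereal_def Let_def)
    then show ?thesis using delta by (simp add: prob_space)
  next
    case False
    then obtain x where x: "x \<in> distr_feasible A b C \<xi>" "?vD = ereal (c \<bullet> x)"
      by (rule distr_opt_attained)
    then have Ax: "A *v x = b" and x0: "\<And>t. 0 \<le> x $ t" and xC: "\<And>t. x $ t \<le> C * \<xi> $ t"
      by (auto simp: distr_feasible_def less_eq_vec_def)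
    define p where "p = embed_pmf (\<lambda>t. \<xi> $ t)"
    have pmf: "pmf p t = \<xi> $ t" for t
      unfolding p_def
      by (rule pmf_embed_pmf) (simp_all add: xi_nonneg nn_integral_count_space_finite xi_sum)
    \<comment> \<open>The likelihood ratio \<open>r\<close> turns \<open>x\<close> into expectations under \<open>\<xi>\<close>. Where \<open>\<xi> $ t = 0\<close>, also
      \<open>x $ t = 0\<close>, so the value \<open>x $ t / 0 = 0\<close> is harmless.\<close>
    define r where "r t = x $ t / \<xi> $ t" for t
    have r: "0 \<le> r t" "r t \<le> C" "\<xi> $ t * r t = x $ t" for t
    proof -
      show "0 \<le> r t" using x0 xi_nonneg by (simp add: r_def)
      show "\<xi> $ t * r t = x $ t" using x0[of t] xC[of t] by (cases "\<xi> $ t = 0") (auto simp: r_def)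
      show "r t \<le> C"
        using xC[of t] xi_nonneg[of t] C_pos by (cases "\<xi> $ t = 0") (auto simp: r_def divide_le_eq)
    qed
    have mean: "measure_pmf.expectation p (\<lambda>t. g t * r t) = (\<Sum>t\<in>UNIV. g t * x $ t)" for g
      unfolding expectation_finite_pmf pmf by (simp flip: r(3) add: mult_ac)
    have bound: "\<bar>g t * r t\<bar> \<le> B * C" if "\<bar>g t\<bar> \<le> B" for g :: "'n \<Rightarrow> real" and t B
    proof -
      have "\<bar>g t\<bar> * \<bar>r t\<bar> \<le> B * C"
        using that r(1,2)[of t] by (intro mult_mono) auto
      then show ?thesis by (simp add: abs_mult)
    qed
    have "\<bar>c $ t\<bar> \<le> 1" for t using component_le_norm_cart[of c t] norm_c by simp
    then have c_bound: "\<bar>c $ t * r t\<bar> \<le> C" for t using bound[of "\<lambda>t. c $ t" t 1] by simp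
    have A_bound: "\<bar>A $ i $ t * r t\<bar> \<le> max_norm A * C" for i t
      by (rule bound[of "\<lambda>t. A $ i $ t"]) (rule abs_entry_le_max_norm)
    obtain p0 where "dual_basic_solution A c p0"
      using dual_basic_solution_exists[OF rank_A] by blast
    then have \<gamma>: "0 \<le> \<gamma>" by (rule order_trans[OF infnorm_pos_le gamma])
    define F where "F h = sample_mean (\<lambda>t. c $ t * r t) h +
      \<gamma> * (\<Sum>i\<in>UNIV. \<bar>sample_mean (\<lambda>t. A $ i $ t * r t) h -
        measure_pmf.expectation p (\<lambda>t. A $ i $ t * r t)\<bar>)" for h :: "'k \<Rightarrow> 'n"
    \<comment> \<open>The product runs over all of \<open>'k\<close>, so the default value
      \<open>undefined\<close> is never taken.\<close>
    let ?Q = "Pi_pmf UNIV undefined (\<lambda>_. p) :: ('k \<Rightarrow> 'n) pmf"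
    have P_if: "P h" if h: "F h \<le> c \<bullet> x + ?T (ln (1 / \<delta>))" for h
      unfolding P_def Let_def
    proof
      assume feas: "std_feasible (select_cols A h) b \<noteq> {} \<and> rank (select_cols A h) = CARD('m)"
      define y :: "real^'k" where "y = (\<chi> k. r (h k) / CARD('k))"
      have "0 \<le> y" by (simp add: y_def less_eq_vec_def r)
      have cy: "select_entries c h \<bullet> y = sample_mean (\<lambda>t. c $ t * r t) h"
        by (simp add: y_def select_entries_def inner_vec_def sample_mean_def sum_divide_distrib)
      have Ay: "(select_cols A h *v y) $ i = sample_mean (\<lambda>t. A $ i $ t * r t) h" for i
        by (simp add: y_def select_cols_def matrix_vector_mult_def sample_mean_def sum_divide_distrib)
      \<comment> \<open>Row \<open>i\<close> has mean \<open>b $ i\<close>, so the deviations in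
        \<open>F\<close> are exactly the residual of \<open>y\<close>.\<close>
      have b: "measure_pmf.expectation p (\<lambda>t. A $ i $ t * r t) = b $ i" for i
        unfolding mean Ax[symmetric] by (simp add: matrix_vector_mult_def)
      have "opt_value (select_entries c h) (std_feasible (select_cols A h) b) \<le> ereal (F h)"
        using sampled_opt_value_le[where A = A and h = h and b = b and c = c and \<gamma> = \<gamma> and y = y,
            OF gamma conjunct1[OF feas] conjunct2[OF feas] \<open>0 \<le> y\<close>]
        unfolding cy Ay F_def b by assumption
      \<comment> \<open>Concentration yields \<open>ln (1 / \<delta>)\<close>; monotonicity passes
        to the stated \<open>ln (2 / \<delta>)\<close>.\<close>
      also have "F h \<le> c \<bullet> x + ?T (ln (2 / \<delta>))"
      proof -
        have "0 \<le> max_norm A" by (rule order_trans[OF abs_ge_zero abs_entry_le_max_norm])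
        moreover have "ln (1 / \<delta>) \<le> ln (2 / \<delta>)" using delta by (simp add: divide_right_mono)
        ultimately have "?T (ln (1 / \<delta>)) \<le> ?T (ln (2 / \<delta>))"
          using \<gamma> C_pos
          by (intro mult_left_mono add_left_mono real_sqrt_le_mono divide_nonneg_nonneg mult_nonneg_nonneg
            add_nonneg_nonneg) simp_all
        with h show ?thesis by linarith
      qed
      finally show "opt_value (select_entries c h) (std_feasible (select_cols A h) b) - ?vP
          \<le> ?vD - ?vP + ereal (?T (ln (2 / \<delta>)))"
        unfolding v x(2)
        by (cases "opt_value (select_entries c h) (std_feasible (select_cols A h) b)") auto
    qed
    have scale: "C + \<gamma> * CARD('m) * (max_norm A * C) = C * (1 + CARD('m) * \<gamma> * max_norm A)"
      by (simp add: algebra_simps)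
    have cx: "measure_pmf.expectation p (\<lambda>t. c $ t * r t) = c \<bullet> x"
      by (simp add: mean inner_vec_def)
    have "1 - \<delta> \<le> measure_pmf.prob ?Q {h. F h \<le> c \<bullet> x + ?T (ln (1 / \<delta>))}"
      using sample_means_concentration[where p = p and dflt = undefined and 'a = 'k
          and f = "\<lambda>t. c $ t * r t" and g = "\<lambda>i t. A $ i $ t * r t",
          OF c_bound A_bound \<gamma> C_pos delta]
      unfolding F_def scale cx .
    also have "\<dots> \<le> measure_pmf.prob ?Q {h. P h}"
      using P_if by (intro measure_pmf.finite_measure_mono) auto
    also have "\<dots> = prob {\<omega> \<in> space M. P (\<lambda>k. j k \<omega>)}"
      by (rule prob_indep_vars_Pi_pmf[symmetric]) (simp_all add: indep distribution pmf)
    finally show ?thesis .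
  qed
  then show ?thesis unfolding P_def .
qed

end
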